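(* Let $m\in\{3,4\}$ and let $n\ge m$ be an integer. (i) If $m=3$, then $s(K_3\Box K_n)=n+\left\lfloor\frac{n}{3}\right\rfloor+1$. (ii) If $m=4$, then $s(K_4\Box K_n)=n+4\left\lfloor\frac{n}{5}\right\rfloor+\max\{i,1\}$, where $i\in\{0,1,2,3,4\}$ satisfies $i\equiv n \pmod 5$.
   Context: For a connected graph $G$ and $X\subseteq V(G)$, $G[X]$ denotes the subgraph induced by $X$. A set $S\subseteq V(G)$ is a safe set if for every component $C$ of $G[S]$ and every component $D$ of $G-S$ such that some edge joins $C$ and $D$, we have $|C|\ge |D|$. The safe number $s(G)$ is the minimum size of a safe set of $G$. $K_m \Box K_n$ has vertex set $[m]\times[n]$, with $(i,j)$ and $(i',j')$ adjacent iff either $i=i'$ and $j\neq j'$, or $j=j'$ and $i\ne i'$. *)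

theory Defs
  imports "Graph_Theory.Digraph_Component" "HOL-Number_Theory.Cong"
begin

text \<open>
  A finite simple graph is an instance of the locale \<^locale>\<open>graph\<close>: a finite, loop-free,
  symmetric digraph without parallel arcs.  On symmetric digraphs reachability is
  symmetric, so the strongly connected components \<^const>\<open>pre_digraph.sccs\<close> are the ordinary
  connected components, and ``some arc from \<open>C\<close> to \<open>D\<close>'' means ``some edge joins \<open>C\<close> and \<open>D\<close>''.

  A safe set is required to be nonempty: \<open>{}\<close> satisfies the component condition vacuously, and
  would make every safe number 0.
\<close>

definition safe_set :: "('a, 'b) pre_digraph \<Rightarrow> 'a set \<Rightarrow> bool" where
  "safe_set G S \<longleftrightarrow> S \<subseteq> verts G \<and> S \<noteq> {} \<and>
     (\<forall>C \<in> pre_digraph.sccs (G \<restriction> S). \<forall>D \<in> pre_digraph.sccs (G \<restriction> (verts G - S)).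
        (\<exists>u \<in> verts C. \<exists>v \<in> verts D. u \<rightarrow>\<^bsub>G\<^esub> v) \<longrightarrow> card (verts C) \<ge> card (verts D))"

text \<open>
  For a nonempty finite \<open>G\<close> the minimum is over a finite nonempty set, as \<open>verts G\<close> is safe.
\<close>

definition safe_number :: "('a, 'b) pre_digraph \<Rightarrow> nat" where
  "safe_number G = Min (card ` {S. safe_set G S})"

text \<open>\<open>K\<^sub>m \<box> K\<^sub>n\<close>, each edge being represented by its two arcs.\<close>

definition complete_box :: "nat \<Rightarrow> nat \<Rightarrow> (nat \<times> nat) pair_pre_digraph" where
  "complete_box m n =
     \<lparr> pverts = {1..m} \<times> {1..n},
       parcs = {((i, j), (i', j')) | i j i' j'.
                  i \<in> {1..m} \<and> j \<in> {1..n} \<and> i' \<in> {1..m} \<and> j' \<in> {1..n} \<and>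
                  (i = i' \<and> j \<noteq> j' \<or> j = j' \<and> i \<noteq> i')} \<rparr>"

lemma pair_graph_complete_box: "pair_graph (complete_box m n)"
proof
  have "parcs (complete_box m n) \<subseteq> ({1..m} \<times> {1..n}) \<times> ({1..m} \<times> {1..n})"
    by (auto simp: complete_box_def)
  then show "finite (parcs (complete_box m n))"
    by (rule finite_subset) auto
qed (auto simp: complete_box_def symmetric_def sym_def)

lemma connected_complete_box:
  assumes "1 \<le> m" "1 \<le> n"
  shows "connected (with_proj (complete_box m n))"
proof -
  interpret pair_graph "complete_box m n" by (rule pair_graph_complete_box)
  have V: "u \<rightarrow>\<^sup>*\<^bsub>with_proj (complete_box m n)\<^esub> u" if "u \<in> {1..m} \<times> {1..n}" for u
    using that by (intro reachable_refl) (simp add: complete_box_def)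
  have row: "(i, j) \<rightarrow>\<^sup>*\<^bsub>with_proj (complete_box m n)\<^esub> (i, j')"
    if "i \<in> {1..m}" "j \<in> {1..n}" "j' \<in> {1..n}" for i j j'
  proof (cases "j = j'")
    case True
    then show ?thesis using that V by simp
  next
    case False
    then show ?thesis using that by (intro reachable_adjI) (auto simp: complete_box_def)
  qed
  have col: "(i, j) \<rightarrow>\<^sup>*\<^bsub>with_proj (complete_box m n)\<^esub> (i', j)"
    if "i \<in> {1..m}" "i' \<in> {1..m}" "j \<in> {1..n}" for i i' j
  proof (cases "i = i'")
    case True
    then show ?thesis using that V by simp
  next
    case False
    then show ?thesis using that by (intro reachable_adjI) (auto simp: complete_box_def)
  qed
  have "strongly_connected (with_proj (complete_box m n))"
  proof (rule strongly_connectedI)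
    show "verts (with_proj (complete_box m n)) \<noteq> {}"
      using assms by (auto simp: complete_box_def)
  next
    fix u v
    assume "u \<in> verts (with_proj (complete_box m n))" "v \<in> verts (with_proj (complete_box m n))"
    moreover obtain i j i' j' where "u = (i, j)" "v = (i', j')" by (cases u, cases v)
    ultimately show "u \<rightarrow>\<^sup>*\<^bsub>with_proj (complete_box m n)\<^esub> v"
      using reachable_trans[OF row col] by (simp add: complete_box_def)
  qed
  then show ?thesis
    unfolding connected_def strongly_connected_def by (auto intro: reachable_mk_symmetricI)
qed

end

(* Cells of the m by n grid are red (in S) or blue. If every column has two red cells, |S| >= 2n.
   Otherwise some column c has at least m - 1 blue cells, all in one blue component D. If D is
   all of the blue part, safety forces |S| >= mn/2. If not, c has a unique red cell, in row t say,
   and D avoids row t. Let p be the number of columns that are red outside row t. In each of the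
   other q = n - p columns the cell of row t is red. So |S| = (m-1)p + q + r with r extra red
   cells, and |D| >= (m-1)q - r. Safety gives (2m-3)p + 2r >= (m-2)n. If r = 0, the red part has a
   component of size at most (m-1)p next to D, and again |S| >= mn/2. Conversely, r >= 1 extra
   cells placed in the q columns outside row t make such a set connected, hence safe as soon as
   the inequality holds. Minimising n + (m-2)p + r gives p = n div 3, r = 1 for m = 3 and
   p = 2(n div 5), r = max (n mod 5) 1 for m = 4. *)

theory Submission
  imports Defs
begin

section \<open>Components of induced subgraphs as vertex sets\<close>

definition component_in :: "('a, 'b) pre_digraph \<Rightarrow> 'a set \<Rightarrow> 'a \<Rightarrow> 'a set" where
  "component_in G X u = {v. u \<rightarrow>\<^sup>*\<^bsub>G \<restriction> X\<^esub> v}"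

lemma component_in_subset: "component_in G X u \<subseteq> X"
  by (auto simp: component_in_def reachable_def dest: in_rtrancl_on_in_F)

context wf_digraph
begin

lemma component_in_self: "u \<in> X \<Longrightarrow> u \<in> component_in G X u"
  by (simp add: component_in_def reachable_def)

lemma component_in_step:
  assumes "v \<in> component_in G X u" "v \<rightarrow>\<^bsub>G\<^esub> w" "w \<in> X"
  shows "w \<in> component_in G X u"
proof -
  interpret X: wf_digraph "G \<restriction> X" by (rule wellformed_induce_subgraph)
  have "v \<in> X" using assms(1) component_in_subset by fastforce
  then have "v \<rightarrow>\<^bsub>G \<restriction> X\<^esub> w" using assms(2,3) by (auto simp: arcs_ends_conv)
  then show ?thesis
    using assms(1) by (auto simp: component_in_def intro: X.reachable_adj_trans)
qed

text \<open>Induction along a path from \<open>u\<close>. This bounds components from above, while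
  \<open>component_in_step\<close> shows that cells belong to them.\<close>

lemma component_in_invariant:
  assumes "u \<in> I" "\<And>v w. v \<in> I \<Longrightarrow> v \<in> X \<Longrightarrow> w \<in> X \<Longrightarrow> v \<rightarrow>\<^bsub>G\<^esub> w \<Longrightarrow> w \<in> I"
  shows "component_in G X u \<subseteq> I"
proof
  interpret X: wf_digraph "G \<restriction> X" by (rule wellformed_induce_subgraph)
  fix v assume "v \<in> component_in G X u"
  then have "u \<rightarrow>\<^sup>*\<^bsub>G \<restriction> X\<^esub> v" by (simp add: component_in_def)
  then show "v \<in> I"
  proof (induction rule: X.reachable_induct)
    case base
    show ?case by (fact assms(1))
  next
    case (step v w)
    then show ?case using assms(2)[of v w] X.adj_in_verts[OF step(2)]
      by (auto dest: dominates_induce_subgraphD)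
  qed
qed

end

text \<open>An induced subgraph of a symmetric digraph is symmetric, so one-way reachability already
  describes its strongly connected components.\<close>

lemma (in sym_digraph) verts_sccs_induce_subgraph:
  assumes "X \<subseteq> verts G"
  shows "verts ` pre_digraph.sccs (G \<restriction> X) = component_in G X ` X"
proof -
  interpret X: wf_digraph "G \<restriction> X" by (rule wellformed_induce_subgraph)
  have "symmetric (G \<restriction> X)"
    by (rule induced_graph_imp_symmetric[OF sym_arcs]) (use assms in \<open>rule induced_induce\<close>)
  then have "X.scc_of u = component_in G X u" for u
    by (auto simp: X.scc_of_def component_in_def dest: symmetric_reachable)
  then show ?thesis
    by (simp flip: X.sccs_verts_conv add: X.sccs_verts_conv_scc_of)
qed

lemma (in sym_digraph) component_in_eq:
  assumes "X \<subseteq> verts G" "v \<in> component_in G X u"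
  shows "component_in G X v = component_in G X u"
proof -
  interpret X: wf_digraph "G \<restriction> X" by (rule wellformed_induce_subgraph)
  have sym: "symmetric (G \<restriction> X)"
    by (rule induced_graph_imp_symmetric[OF sym_arcs]) (use assms(1) in \<open>rule induced_induce\<close>)
  show ?thesis
    using assms(2) symmetric_reachable[OF sym] X.reachable_trans
    unfolding component_in_def by blast
qed

text \<open>Two components joined by an edge can be represented by the ends of that edge, so it
  suffices to test adjacent pairs of vertices.\<close>

lemma (in sym_digraph) safe_set_iff:
  "safe_set G S \<longleftrightarrow> S \<subseteq> verts G \<and> S \<noteq> {} \<and>
     (\<forall>u \<in> S. \<forall>v \<in> verts G - S. u \<rightarrow>\<^bsub>G\<^esub> v \<longrightarrow>
        card (component_in G (verts G - S) v) \<le> card (component_in G S u))"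
proof (cases "S \<subseteq> verts G")
  case True
  let ?T = "verts G - S"
  have sccs: "(\<forall>C \<in> pre_digraph.sccs (G \<restriction> X). P (verts C)) \<longleftrightarrow> (\<forall>u \<in> X. P (component_in G X u))"
    if "X \<subseteq> verts G" for X P
    using verts_sccs_induce_subgraph[OF that] by (metis (no_types, lifting) image_iff)
  have "safe_set G S \<longleftrightarrow> S \<noteq> {} \<and>
     (\<forall>u \<in> S. \<forall>v \<in> ?T. (\<exists>x \<in> component_in G S u. \<exists>y \<in> component_in G ?T v. x \<rightarrow>\<^bsub>G\<^esub> y) \<longrightarrow>
        card (component_in G ?T v) \<le> card (component_in G S u))"
    unfolding safe_set_def
    by (subst sccs, fact True, subst sccs[of ?T]) (use True in auto)
  also have "\<dots> \<longleftrightarrow> S \<noteq> {} \<and>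
     (\<forall>u \<in> S. \<forall>v \<in> ?T. u \<rightarrow>\<^bsub>G\<^esub> v \<longrightarrow>
        card (component_in G ?T v) \<le> card (component_in G S u))"
    using component_in_eq[OF True] component_in_eq[of ?T] component_in_self
      component_in_subset[of G S] component_in_subset[of G ?T]
    by (smt (verit, best) Diff_subset subsetD)
  finally show ?thesis using True by blast
qed (simp add: safe_set_def)


section \<open>The grid graph: vertices, adjacency, counting by columns\<close>

definition box :: "nat \<Rightarrow> nat \<Rightarrow> (nat \<times> nat, (nat \<times> nat) \<times> nat \<times> nat) pre_digraph" where
  "box m n = with_proj (complete_box m n)"

lemma graph_box: "graph (box m n)"
  unfolding box_def by (rule pair_graph.pair_graphD_graph[OF pair_graph_complete_box])

lemma verts_box: "verts (box m n) = {1..m} \<times> {1..n}"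
  by (simp add: box_def complete_box_def)

lemma dominates_box_iff:
  "u \<rightarrow>\<^bsub>box m n\<^esub> v \<longleftrightarrow> u \<in> {1..m} \<times> {1..n} \<and> v \<in> {1..m} \<times> {1..n} \<and>
     (fst u = fst v \<and> snd u \<noteq> snd v \<or> snd u = snd v \<and> fst u \<noteq> fst v)"
  by (cases u; cases v) (auto simp: box_def complete_box_def)

lemma card_eq_sum_columns:
  assumes "S \<subseteq> {1..m} \<times> {1..n::nat}"
  shows "card S = (\<Sum>j\<in>{1..n}. card {i \<in> {1..m::nat}. (i, j) \<in> S})"
proof -
  have "bij_betw prod.swap S (SIGMA j:{1..n}. {i \<in> {1..m}. (i, j) \<in> S})"
    by (rule bij_betwI[where g = prod.swap]) (use assms in auto)
  then have "card S = card (SIGMA j:{1..n}. {i \<in> {1..m}. (i, j) \<in> S})"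
    by (rule bij_betw_same_card)
  then show ?thesis by simp
qed

section \<open>Lower bound: the shape of a safe set\<close>

text \<open>The disjuncts are the outcomes of the case analysis. The second arises twice: when all
  blue cells form one component, and when there are no extra red cells. Only the third has free
  parameters; they are optimised separately for \<open>m = 3\<close> and
  \<open>m = 4\<close>.\<close>

lemma card_safe_set_box:
  assumes "3 \<le> m" "1 \<le> n" "safe_set (box m n) S"
  shows "2 * n \<le> card S \<or> m * n \<le> 2 * card S \<or>
    (\<exists>p r. p \<le> n \<and> 1 \<le> r \<and> card S = n + (m - 2) * p + r \<and>
       (m - 2) * n \<le> (2 * m - 3) * p + 2 * r)"
proof -
  interpret graph "box m n" by (rule graph_box)
  let ?G = "box m n"
  define T where "T = verts ?G - S"
  have S: "S \<subseteq> {1..m} \<times> {1..n}" "S \<noteq> {}"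
    and safe: "\<And>u v. u \<in> S \<Longrightarrow> v \<in> T \<Longrightarrow> u \<rightarrow>\<^bsub>?G\<^esub> v \<Longrightarrow>
      card (component_in ?G T v) \<le> card (component_in ?G S u)"
    using assms(3) unfolding safe_set_iff T_def by (auto simp: verts_box)
  have fin: "finite S" using S(1) by (rule finite_subset) simp
  have T: "T = {1..m} \<times> {1..n} - S" by (simp only: T_def verts_box)
  \<comment> \<open>This avoids truncated subtraction: \<open>m - 1\<close> becomes
    \<open>k + 1\<close> and \<open>2 * m - 3\<close> becomes \<open>2 * k + 1\<close>.\<close>
  obtain k where k: "m = k + 2" "k \<ge> 1"
    using assms(1) by (intro that[of "m - 2"]) auto
  consider (dense) "\<forall>j\<in>{1..n}. 2 \<le> card {i \<in> {1..m}. (i, j) \<in> S}"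
    | (sparse) c where "c \<in> {1..n}" "card {i \<in> {1..m}. (i, c) \<in> S} \<le> 1"
    by fastforce
  then show ?thesis
  proof cases
    case dense
    then have "card {1..n} * 2 \<le> card S"
      unfolding card_eq_sum_columns[OF S(1)]
      using sum_bounded_below[of "{1..n}" 2 "\<lambda>j. card {i \<in> {1..m}. (i, j) \<in> S}"] by simp
    then show ?thesis by simp
  next
    case sparse
    define R where "R = {i \<in> {1..m}. (i, c) \<notin> S}"
    have R_sub: "R \<subseteq> {1..m}" "finite R" by (auto simp: R_def)
    have "R = {1..m} - {i \<in> {1..m}. (i, c) \<in> S}" by (auto simp: R_def)
    then have "card R = m - card {i \<in> {1..m}. (i, c) \<in> S}" by (simp only:) (subst card_Diff_subset, auto)
    then have card_R: "k + 1 \<le> card R" using sparse(2) k by linarith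
    then obtain i0 where i0: "i0 \<in> R" by (cases "R = {}") auto
    define D where "D = component_in ?G T (i0, c)"
    have D_sub: "D \<subseteq> T" by (simp add: D_def component_in_subset)
    have fin_D: "finite D" using D_sub by (rule finite_subset) (simp add: T)
    have closed: "w \<in> D" if "v \<in> D" "w \<in> T" "v \<rightarrow>\<^bsub>?G\<^esub> w" for v w
      using that component_in_step unfolding D_def by blast
    have i0c: "(i0, c) \<in> D"
      unfolding D_def by (rule component_in_self) (use i0 sparse(1) in \<open>auto simp: T R_def\<close>)
    have adj: "(i, j) \<rightarrow>\<^bsub>?G\<^esub> (i', j')"
      if "i \<in> {1..m}" "j \<in> {1..n}" "i' \<in> {1..m}" "j' \<in> {1..n}"
        "i = i' \<and> j \<noteq> j' \<or> j = j' \<and> i \<noteq> i'" for i j i' j'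
      unfolding dominates_box_iff using that by auto
    have column: "(i, c) \<in> D" if "i \<in> R" for i
    proof (cases "i = i0")
      case False
      show ?thesis
        by (rule closed[OF i0c]) (use False that i0 sparse(1) in \<open>auto simp: T R_def intro!: adj\<close>)
    qed (simp add: i0c)
    \<comment> \<open>Such a cell is joined along its row to the cell in column \<open>c\<close>,
      which is blue and lies in \<open>D\<close>.\<close>
    have row: "(i, j) \<in> D" if "i \<in> R" "(i, j) \<in> T" for i j
    proof (cases "j = c")
      case False
      show ?thesis
        by (rule closed[OF column[OF that(1)]])
          (use False that sparse(1) in \<open>auto simp: T R_def intro!: adj\<close>)
    qed (simp add: column that)
    \<comment> \<open>Every cell of \<open>D\<close> has \<open>D\<close> as its blue component, so
      safety bounds \<open>card D\<close> at any edge leaving \<open>D\<close>.\<close>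
    have D_le: "card D \<le> card (component_in ?G S u)" if "u \<in> S" "v \<in> D" "u \<rightarrow>\<^bsub>?G\<^esub> v" for u v
    proof -
      have "component_in ?G T v = D"
        unfolding D_def by (rule component_in_eq) (use that(2) in \<open>auto simp: T_def D_def\<close>)
      then show ?thesis using safe[of u v] that D_sub by auto
    qed
    have component_le: "card (component_in ?G S u) \<le> card S" for u
      by (rule card_mono[OF fin component_in_subset])
    show ?thesis
    proof (cases "T \<subseteq> D")
      case True
      obtain a b where ab: "(a, b) \<in> S" using S(2) by auto
      then have ab': "a \<in> {1..m}" "b \<in> {1..n}" using S(1) by auto
      \<comment> \<open>In the row of the red cell \<open>(a, b)\<close>, the cell
        \<open>(a, c)\<close> is either blue, hence in \<open>D\<close>, or red and next to
        \<open>(i0, c)\<close> in column \<open>c\<close>.\<close>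
      have "\<exists>u\<in>S. \<exists>v\<in>D. u \<rightarrow>\<^bsub>?G\<^esub> v"
      proof (cases "a \<in> R")
        case True
        then have "(a, b) \<rightarrow>\<^bsub>?G\<^esub> (a, c)"
          by (intro adj) (use ab ab' sparse(1) in \<open>auto simp: R_def\<close>)
        then show ?thesis using ab column[OF True] by blast
      next
        case False
        then have "(a, c) \<in> S" using ab' by (auto simp: R_def)
        moreover have "(a, c) \<rightarrow>\<^bsub>?G\<^esub> (i0, c)"
          by (intro adj) (use False ab' i0 sparse(1) in \<open>auto simp: R_def\<close>)
        ultimately show ?thesis using i0c by blast
      qed
      then obtain u v where "u \<in> S" "v \<in> D" "u \<rightarrow>\<^bsub>?G\<^esub> v" by blast
      then have "card D \<le> card S" by (rule order_trans[OF D_le component_le])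
      moreover have "card D = m * n - card S"
        unfolding subset_antisym[OF D_sub True] T using S(1) fin by (simp add: card_Diff_subset)
      ultimately show ?thesis by linarith
    next
      case False
      then obtain t c' where t: "(t, c') \<in> T" "(t, c') \<notin> D" by auto
      \<comment> \<open>A blue cell outside \<open>D\<close> lies in a row outside \<open>R\<close>.
        As \<open>R\<close> has at least \<open>m - 1\<close> rows, it consists of all rows but
        \<open>t\<close>.\<close>
      then have "t \<notin> R" using row by blast
      moreover have t_m: "t \<in> {1..m}" using t(1) by (auto simp: T)
      ultimately have "R \<subseteq> {1..m} - {t}" using R_sub by auto
      then have R: "R = {1..m} - {t}"
        by (rule card_seteq[rotated]) (use card_R k t_m in auto)
      have card_R': "card R = k + 1" using R t_m k by simp
      have tc: "(t, c) \<in> S" using \<open>t \<notin> R\<close> t_m by (auto simp: R_def)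
      have row_t: "(t, j) \<notin> D" for j
      proof
        assume tj: "(t, j) \<in> D"
        then have "j \<in> {1..n}" using D_sub by (auto simp: T)
        then have "(t, c') \<in> D"
          by (cases "j = c'") (use tj t in \<open>auto simp: T intro!: closed[OF tj] adj\<close>)
        then show False using t(2) by simp
      qed
      txt \<open>Each column outside \<open>P\<close> meets \<open>D\<close>, so a blue cell of row \<open>t\<close> in it would lie in \<open>D\<close>.\<close>
      define P where "P = {j \<in> {1..n}. \<forall>i\<in>R. (i, j) \<in> S}"
      define Q where "Q = {1..n} - P"
      define E where "E = S \<inter> ({t} \<times> P \<union> R \<times> Q)"
      have fins: "finite P" "finite Q" "finite E" using fin by (auto simp: P_def Q_def E_def)
      have "P \<subseteq> {1..n}" by (auto simp: P_def)
      then have pq: "card P + card Q = n"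
        unfolding Q_def using card_mono[of "{1..n}" P] by (simp add: card_Diff_subset fins(1))
      have tQ: "(t, j) \<in> S" if j: "j \<in> Q" for j
      proof (rule ccontr)
        assume nS: "(t, j) \<notin> S"
        obtain i where i: "i \<in> R" "(i, j) \<notin> S" using j by (auto simp: P_def Q_def)
        have jn: "j \<in> {1..n}" using j by (simp add: Q_def)
        have "(i, j) \<in> D" by (rule row[OF i(1)]) (use i jn R_sub in \<open>auto simp: T\<close>)
        then have "(t, j) \<in> D"
          by (rule closed) (use i jn t_m nS R in \<open>auto simp: T intro!: adj\<close>)
        then show False using row_t by simp
      qed
      \<comment> \<open>The red cells in \<open>R \<times> P\<close> and
        \<open>{t} \<times> Q\<close> are forced, by the choice of \<open>P\<close> and by
        \<open>tQ\<close>; \<open>E\<close> holds the extra ones.\<close>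
      have S_eq: "S = (R \<times> P \<union> {t} \<times> Q) \<union> E"
      proof
        show "S \<subseteq> (R \<times> P \<union> {t} \<times> Q) \<union> E"
          using S(1) by (auto simp: E_def R Q_def)
        show "(R \<times> P \<union> {t} \<times> Q) \<union> E \<subseteq> S"
          using tQ by (auto simp: E_def P_def)
      qed
      have tR: "t \<notin> R" by (simp add: R)
      have PQ: "P \<inter> Q = {}" by (auto simp: Q_def)
      have "card S = card (R \<times> P \<union> {t} \<times> Q) + card E"
        by (subst (1) S_eq, rule card_Un_disjoint) (use fins R_sub(2) tR PQ in \<open>auto simp: E_def\<close>)
      also have "card (R \<times> P \<union> {t} \<times> Q) = card (R \<times> P) + card ({t} \<times> Q)"
        by (rule card_Un_disjoint) (use fins R_sub(2) tR in auto)
      finally have card_S: "card S = (k + 1) * card P + card Q + card E"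
        by (simp add: card_cartesian_product card_R')
      \<comment> \<open>The blue cells of \<open>R \<times> Q\<close> lie in \<open>D\<close> by
        \<open>row\<close>; this bounds \<open>card D\<close> from below.\<close>
      have "R \<times> Q \<subseteq> D \<union> E"
      proof safe
        fix i j assume ij: "i \<in> R" "j \<in> Q" "(i, j) \<notin> E"
        then show "(i, j) \<in> D"
          by (intro row) (use R_sub in \<open>auto simp: E_def T Q_def\<close>)
      qed
      then have "card (R \<times> Q) \<le> card D + card E"
        using card_mono[of "D \<union> E" "R \<times> Q"] card_Un_le[of D E] fin_D fins by simp
      then have card_D: "(k + 1) * card Q \<le> card D + card E"
        by (simp add: card_cartesian_product card_R')
      have "(t, c) \<rightarrow>\<^bsub>?G\<^esub> (i0, c)"
        by (intro adj) (use i0 t_m sparse(1) R in auto)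
      then have "card D \<le> card S" by (rule order_trans[OF D_le[OF tc i0c] component_le])
      then have "(k + 1) * card Q \<le> (k + 1) * card P + card Q + 2 * card E"
        using card_D card_S by linarith
      then have ineq: "k * n \<le> (2 * k + 1) * card P + 2 * card E"
        by (simp add: algebra_simps flip: pq)
      show ?thesis
      proof (cases "card E = 0")
        case False
        show ?thesis
          using ineq card_S pq False k
          by (intro disjI2 exI[of _ "card P"] exI[of _ "card E"]) (auto simp: algebra_simps)
      next
        \<comment> \<open>Without extra cells the red blocks \<open>R \<times> P\<close> and
          \<open>{t} \<times> Q\<close> share neither row nor column. A red component inside
          \<open>R \<times> P\<close> stays there, which sharpens the bound \<open>card S\<close> on
          \<open>card D\<close> to \<open>card (R \<times> P)\<close>. If \<open>P\<close> were
          empty, \<open>ineq\<close> would force \<open>k * n = 0\<close>.\<close>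
        case True
        then have E: "E = {}" using fins by simp
        have "0 < k * n" using k(2) assms(2) by simp
        then have "card P \<noteq> 0" using ineq True by (metis add_0 mult_0_right not_le)
        then obtain j where j: "j \<in> P" by fastforce
        then have i0j: "(i0, j) \<in> S" using i0 by (auto simp: P_def)
        have "(i0, j) \<rightarrow>\<^bsub>?G\<^esub> (i0, c)"
          by (intro adj) (use i0 i0j i0c D_sub sparse(1) R j in \<open>auto simp: T P_def\<close>)
        then have "card D \<le> card (component_in ?G S (i0, j))" by (rule D_le[OF i0j i0c])
        also have "\<dots> \<le> card (R \<times> P)"
        proof (intro card_mono component_in_invariant)
          show "finite (R \<times> P)" using R_sub fins by simp
          show "(i0, j) \<in> R \<times> P" using i0 j by simp
          fix v w assume "v \<in> R \<times> P" "w \<in> S" "v \<rightarrow>\<^bsub>?G\<^esub> w"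
          then show "w \<in> R \<times> P"
            using tR PQ unfolding dominates_box_iff by (subst (asm) S_eq) (auto simp: E)
        qed
        finally have "(k + 1) * card Q \<le> (k + 1) * card P"
          using card_D E by (simp add: card_cartesian_product card_R')
        then have "card Q \<le> card P" by (simp only: mult_le_cancel1)
        \<comment> \<open>Over the integers, \<open>2 * card S - m * n\<close> equals
          \<open>k * (card P - card Q)\<close>.\<close>
        then have "k * card Q \<le> k * card P" by simp
        then have "m * n \<le> 2 * card S"
          unfolding card_S k by (simp add: algebra_simps E flip: pq)
        then show ?thesis by simp
      qed
    qed
  qed
qed

section \<open>Upper bound: connected safe sets\<close>

text \<open>Row \<open>m\<close> plays the part of \<open>t\<close>, and the first \<open>p\<close>
  columns are red outside it. The red set is connected, so its size must only reach that of each
  blue component. One kind lies in \<open>{m} \<times> P\<close> and has at most \<open>p\<close>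
  cells; the other has at most \<open>(m - 1) * q - r\<close> cells, and the last hypothesis
  compares this with \<open>card S\<close>.\<close>

lemma ex_safe_set_box:
  assumes "2 \<le> m" "p + q = n" "1 \<le> q" "1 \<le> r" "r \<le> (m - 1) * q"
    and "(m - 1) * q \<le> (m - 1) * p + q + 2 * r"
  shows "\<exists>S. safe_set (box m n) S \<and> card S = (m - 1) * p + q + r"
proof -
  interpret graph "box m n" by (rule graph_box)
  let ?G = "box m n"
  define R P Q where "R = {1..m - 1}" and "P = {1..p}" and "Q = {p + 1..n}"
  have cards: "card R = m - 1" "card P = p" "card Q = q"
    and fins: "finite R" "finite P" "finite Q"
    and disj: "m \<notin> R" "P \<inter> Q = {}"
    and V: "{1..m} = insert m R" "{1..n} = P \<union> Q"
    using assms by (auto simp: R_def P_def Q_def)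
  have "r \<le> card (R \<times> Q)" using assms(5) by (simp add: card_cartesian_product cards)
  then obtain E where E: "E \<subseteq> R \<times> Q" "card E = r" "finite E"
    by (rule obtain_subset_with_card_n)
  obtain a b where ab: "(a, b) \<in> E" using E(2) assms(4) by (cases "E = {}") auto
  define S where "S = (R \<times> P \<union> {m} \<times> Q) \<union> E"
  have "card S = card (R \<times> P \<union> {m} \<times> Q) + card E"
    unfolding S_def by (rule card_Un_disjoint) (use fins E disj in auto)
  also have "card (R \<times> P \<union> {m} \<times> Q) = card (R \<times> P) + card ({m} \<times> Q)"
    by (rule card_Un_disjoint) (use fins disj in auto)
  finally have card_S: "card S = (m - 1) * p + q + r"
    by (simp add: card_cartesian_product cards E)
  have S_sub: "S \<subseteq> verts ?G"
    unfolding verts_box V S_def using E(1) by auto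
  define T where "T = verts ?G - S"
  have T_sub: "T \<subseteq> {m} \<times> P \<union> (R \<times> Q - E)"
    unfolding T_def verts_box V S_def by auto
  have adj: "(i, j) \<rightarrow>\<^bsub>?G\<^esub> (i', j')"
    if "(i, j) \<in> S" "(i', j') \<in> S" "i = i' \<and> j \<noteq> j' \<or> j = j' \<and> i \<noteq> i'" for i j i' j'
    unfolding dominates_box_iff
    using that(3) subsetD[OF S_sub that(1)] subsetD[OF S_sub that(2)] by (simp add: verts_box)
  have step: "(i', j') \<in> component_in ?G S u"
    if "(i, j) \<in> component_in ?G S u" "(i', j') \<in> S" "i = i' \<or> j = j'" for u i j i' j'
  proof (cases "(i, j) = (i', j')")
    case False
    have "(i, j) \<in> S" by (rule subsetD[OF component_in_subset that(1)])
    then show ?thesis using False that by (intro component_in_step[OF that(1)] adj) auto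
  qed (use that(1) in simp)
  txt \<open>The extra red cell \<open>(a, b)\<close> links the two red blocks \<open>R \<times> P\<close> and \<open>{m} \<times> Q\<close>.\<close>
  have hub: "(m, b) \<in> component_in ?G S u" if u: "u \<in> S" for u
  proof -
    obtain i j where ij: "u = (i, j)" by fastforce
    have self: "(i, j) \<in> component_in ?G S u" using component_in_self[OF u] ij by simp
    have ab_S: "(a, b) \<in> S" "(m, b) \<in> S" using ab E(1) by (auto simp: S_def)
    consider "i \<in> R" "j \<in> P" | "j \<in> Q" using u ij E(1) by (auto simp: S_def)
    then show ?thesis
    proof cases
      case 1
      then have "(a, j) \<in> S" using ab E(1) by (auto simp: S_def)
      then have "(a, j) \<in> component_in ?G S u" by (intro step[OF self]) auto
      then have "(a, b) \<in> component_in ?G S u" by (rule step) (use ab_S in auto)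
      then show ?thesis by (rule step) (use ab_S in auto)
    next
      case 2
      then have "(m, j) \<in> S" by (auto simp: S_def)
      then have "(m, j) \<in> component_in ?G S u" by (intro step[OF self]) auto
      then show ?thesis by (rule step) (use ab_S in auto)
    qed
  qed
  have connected: "component_in ?G S u = S" if "u \<in> S" for u
  proof
    show "S \<subseteq> component_in ?G S u"
    proof
      fix v assume "v \<in> S"
      then have "component_in ?G S v = component_in ?G S u"
        using component_in_eq[OF S_sub hub[OF that]] component_in_eq[OF S_sub hub, of v] by simp
      then show "v \<in> component_in ?G S u" using component_in_self \<open>v \<in> S\<close> by blast
    qed
  qed (rule component_in_subset)
  have small: "card (component_in ?G T v) \<le> card S" if v: "v \<in> T" for v
  proof (cases "v \<in> {m} \<times> P")
    case True
    have "component_in ?G T v \<subseteq> {m} \<times> P"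
      by (rule component_in_invariant[OF True]) (use T_sub disj in \<open>fastforce simp: dominates_box_iff\<close>)
    then have "card (component_in ?G T v) \<le> card ({m} \<times> P)"
      by (rule card_mono[rotated]) (simp add: fins)
    also have "\<dots> = 1 * p" by (simp add: card_cartesian_product cards)
    also have "\<dots> \<le> (m - 1) * p" by (rule mult_le_mono1) (use assms(1) in simp)
    finally show ?thesis using card_S by linarith
  next
    case False
    then have "v \<in> R \<times> Q - E" using v T_sub by blast
    then have "component_in ?G T v \<subseteq> R \<times> Q - E"
      by (rule component_in_invariant) (use T_sub disj in \<open>fastforce simp: dominates_box_iff\<close>)
    then have "card (component_in ?G T v) \<le> card (R \<times> Q - E)"
      by (rule card_mono[rotated]) (simp add: fins)
    also have "\<dots> = (m - 1) * q - r"
      using E by (simp add: card_Diff_subset card_cartesian_product cards)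
    finally show ?thesis using card_S assms(6) by linarith
  qed
  have "safe_set ?G S"
    unfolding safe_set_iff T_def[symmetric]
    using S_sub ab connected small by (auto simp: S_def)
  then show ?thesis using card_S by blast
qed

section \<open>The safe numbers for \<open>m = 3\<close> and \<open>m = 4\<close>\<close>

lemma safe_number_eqI:
  assumes "finite (verts G)" "safe_set G S" "card S = k"
    and "\<And>S'. safe_set G S' \<Longrightarrow> k \<le> card S'"
  shows "safe_number G = k"
  unfolding safe_number_def
proof (rule Min_eqI)
  have "{S. safe_set G S} \<subseteq> Pow (verts G)" by (auto simp: safe_set_def)
  then show "finite (card ` {S. safe_set G S})"
    using assms(1) by (meson finite_Pow_iff finite_imageI finite_subset)
qed (use assms in auto)

text \<open>The witness has \<open>p = n div 3\<close> and \<open>r = 1\<close>. Taking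
  \<open>p\<close> smaller by \<open>d \<ge> 1\<close> forces \<open>2 * r \<ge> 3 * d\<close>,
  hence \<open>r \<ge> d + 1\<close>, so \<open>p + r\<close> does not drop.\<close>

lemma safe_number_box_3:
  assumes "3 \<le> n"
  shows "safe_number (box 3 n) = n + n div 3 + 1"
proof -
  have "\<exists>S. safe_set (box 3 n) S \<and> card S = (3 - 1) * (n div 3) + (n - n div 3) + 1"
    by (rule ex_safe_set_box) (use assms in auto)
  then obtain S where "safe_set (box 3 n) S" "card S = n + n div 3 + 1" by auto
  then show ?thesis
  proof (rule safe_number_eqI[rotated])
    show "n + n div 3 + 1 \<le> card S'" if S': "safe_set (box 3 n) S'" for S'
    proof -
      consider "2 * n \<le> card S'" | "3 * n \<le> 2 * card S'"
        | p r where "1 \<le> r" "card S' = n + p + r" "n \<le> 3 * p + 2 * r"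
        using card_safe_set_box[OF _ _ S'] assms by auto
      then show ?thesis using assms by cases linarith+
    qed
  qed (simp add: verts_box)
qed

text \<open>With \<open>n = 5 * k + i\<close> and \<open>p = 2 * k\<close>, the constraint
  \<open>2 * n \<le> 5 * p + 2 * r\<close> reads \<open>i \<le> r\<close>; together with
  \<open>1 \<le> r\<close> this gives \<open>r = max i 1\<close>.\<close>

lemma safe_number_box_4:
  assumes "4 \<le> n"
  shows "safe_number (box 4 n) = n + 4 * (n div 5) + max (n mod 5) 1"
proof -
  define k i where "k = n div 5" and "i = n mod 5"
  have n: "n = 5 * k + i" "i < 5" by (simp_all add: k_def i_def)
  have "\<exists>S. safe_set (box 4 n) S \<and> card S = (4 - 1) * (2 * k) + (n - 2 * k) + max i 1"
    by (rule ex_safe_set_box) (use assms n in auto)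
  then obtain S where "safe_set (box 4 n) S" "card S = n + 4 * k + max i 1"
    using n by auto
  then have "safe_number (box 4 n) = n + 4 * k + max i 1"
  proof (rule safe_number_eqI[rotated])
    show "n + 4 * k + max i 1 \<le> card S'" if S': "safe_set (box 4 n) S'" for S'
    proof -
      have half: "n + 4 * k + max i 1 \<le> 2 * n" using n assms by linarith
      \<comment> \<open>For \<open>m = 4\<close> the disjunct \<open>m * n \<le> 2 * card S'\<close>
        is the same as \<open>2 * n \<le> card S'\<close>.\<close>
      consider "2 * n \<le> card S'" | p r where "1 \<le> r" "card S' = n + 2 * p + r" "2 * n \<le> 5 * p + 2 * r"
        using card_safe_set_box[OF _ _ S'] assms by auto
      then show ?thesis
      proof cases
        case (2 p r)
        \<comment> \<open>Each step of \<open>p\<close> below \<open>2 * k\<close> saves 2 but costs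
          5/2 in \<open>r\<close>. At \<open>2 * k + 1\<close> the constraint still gives
          \<open>r \<ge> i - 2\<close>, which can only tie. From \<open>2 * k + 2\<close> on,
          \<open>2 * p + r\<close> is at least \<open>4 * k + 5\<close>, which exceeds
          \<open>4 * k + i\<close>.\<close>
        consider "p \<le> 2 * k" | "p = 2 * k + 1" | "2 * k + 2 \<le> p" by linarith
        then show ?thesis
        proof cases
          case 1
          then show ?thesis using 2 n by linarith
        next
          case 2
          then show ?thesis using \<open>1 \<le> r\<close> \<open>card S' = _\<close> \<open>2 * n \<le> _\<close> n by linarith
        next
          case 3
          then show ?thesis using \<open>1 \<le> r\<close> \<open>card S' = _\<close> n by linarith
        qed
      qed (use half in linarith)
    qed
  qed (simp add: verts_box)
  then show ?thesis by (simp add: k_def i_def)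
qed

theorem theorem3p1:
  fixes m n :: nat
  assumes "m \<in> {3, 4}" and "n \<ge> m"
  shows "(m = 3 \<longrightarrow> safe_number (with_proj (complete_box 3 n)) = n + n div 3 + 1) \<and>
         (m = 4 \<longrightarrow> (\<forall>i \<in> {0, 1, 2, 3, 4}. [i = n] (mod 5) \<longrightarrow>
            safe_number (with_proj (complete_box 4 n)) = n + 4 * (n div 5) + max i 1))"
proof -
  have "m = 3 \<longrightarrow> safe_number (box 3 n) = n + n div 3 + 1"
    using safe_number_box_3 assms(2) by blast
  moreover have "safe_number (box 4 n) = n + 4 * (n div 5) + max i 1"
    if "m = 4" "i \<in> {0, 1, 2, 3, 4}" "[i = n] (mod 5)" for i
  proof -
    have "i = n mod 5" using that(2,3) by (auto simp: cong_def)
    then show ?thesis using safe_number_box_4 assms(2) that(1) by simp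
  qed
  ultimately show ?thesis unfolding box_def by simp
qed

end
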